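(* Let $A=(a_{ij})$ be an $n\times n$ stochastic matrix with spectrum $(1;\lambda_2,\ldots,\lambda_n)$. For each $j=1,\ldots,n$ let $a_j$ and $s_j$ be the smallest entry and the sum of the $j$th column of $A$, respectively. If $$s_j\le 1+n a_j\qquad\text{for all } j=1,\ldots,n,$$ then there exists an $n\times n$ doubly stochastic matrix $B$ with spectrum $\sigma(B)=(1;\lambda_2,\ldots,\lambda_n)$. Moreover, $B$ is the unique closest doubly stochastic matrix to $A$ with respect to the Frobenius norm and has the property that $B$ is cospectral to $A$.
   Context: A stochastic matrix is a square matrix with nonnegative entries each of whose row sums equals $1$; it is doubly stochastic if in addition each column sum equals $1$. The spectrum of a matrix is the list of its eigenvalues counted with multiplicity; the semicolon after the first entry indicates that it is the Perron eigenvalue. Two matrices are cospectral if they have the same spectrum. *)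

theory Defs
  imports "Jordan_Normal_Form.Spectral_Radius"
begin

text \<open>Rows and columns are indexed from 0, so the indices $1, \ldots, n$ become $0, \ldots, n-1$.\<close>

definition stochastic :: "nat \<Rightarrow> real mat \<Rightarrow> bool" where
  "stochastic n A \<longleftrightarrow> A \<in> carrier_mat n n
     \<and> (\<forall>i<n. \<forall>j<n. 0 \<le> A $$ (i, j))
     \<and> (\<forall>i<n. (\<Sum>j<n. A $$ (i, j)) = 1)"

definition doubly_stochastic :: "nat \<Rightarrow> real mat \<Rightarrow> bool" where
  "doubly_stochastic n A \<longleftrightarrow> stochastic n A \<and> (\<forall>j<n. (\<Sum>i<n. A $$ (i, j)) = 1)"

text \<open>The complex eigenvalues of a real matrix, with algebraic multiplicity.\<close>

definition eigenvalue_mset :: "real mat \<Rightarrow> complex multiset" where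
  "eigenvalue_mset A = proots (char_poly (map_mat complex_of_real A))"

definition cospectral :: "real mat \<Rightarrow> real mat \<Rightarrow> bool" where
  "cospectral A B \<longleftrightarrow> eigenvalue_mset A = eigenvalue_mset B"

text \<open>The notation $\sigma(A) = (r; \lambda_2, \ldots, \lambda_n)$: the entries are all eigenvalues of
  $A$ with multiplicity, in no particular order apart from the first one, which is the Perron
  eigenvalue, i.e. the spectral radius.  The list \<open>ls\<close> is $\lambda_2, \ldots, \lambda_n$; its
  length is forced to be $n - 1$ because the characteristic polynomial has degree $n$.\<close>

definition has_spectrum :: "real mat \<Rightarrow> real \<Rightarrow> complex list \<Rightarrow> bool" where
  "has_spectrum A r ls \<longleftrightarrow> eigenvalue_mset A = mset (complex_of_real r # ls)
     \<and> r = spectral_radius (map_mat complex_of_real A)"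

definition col_min :: "real mat \<Rightarrow> nat \<Rightarrow> real" where
  "col_min A j = Min ((\<lambda>i. A $$ (i, j)) ` {..<dim_row A})"

definition col_sum :: "real mat \<Rightarrow> nat \<Rightarrow> real" where
  "col_sum A j = (\<Sum>i<dim_row A. A $$ (i, j))"

definition frobenius_norm :: "real mat \<Rightarrow> real" where
  "frobenius_norm A = sqrt (\<Sum>i<dim_row A. \<Sum>j<dim_col A. \<bar>A $$ (i, j)\<bar>\<^sup>2)"

definition closest_doubly_stochastic :: "nat \<Rightarrow> real mat \<Rightarrow> real mat \<Rightarrow> bool" where
  "closest_doubly_stochastic n A B \<longleftrightarrow>
     is_arg_min (\<lambda>X. frobenius_norm (A - X)) (doubly_stochastic n) B"

end

theory Submission
  imports Defs
begin

text \<open>The matrix \<open>B\<close> with entries \<open>a\<^sub>i\<^sub>j + (1 - s\<^sub>j) / n\<close> has unit row and column sums, and the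
  hypothesis on the column sums says exactly that it is nonnegative.  The correction \<open>N = B - A\<close> has
  constant columns, so \<open>A N = N\<close>, and its rows sum to zero, so \<open>N\<^sup>2 = 0\<close>; hence
  \<open>(x - 1) (x - B) = (x - A) ((x - 1) - N)\<close>, and taking determinants shows that \<open>A\<close> and \<open>B\<close> have the
  same characteristic polynomial.  Finally \<open>N\<close> is orthogonal to every matrix with vanishing column
  sums, so \<open>B\<close> is the orthogonal projection of \<open>A\<close> to the matrices with unit column sums.\<close>

text \<open>Over the complex numbers the characteristic polynomial splits into \<open>n\<close>
  linear factors. An eigenvector for a root \<open>a\<close> is sent by \<open>N * N\<close> to its
  multiple by \<open>a * a\<close>, so every root is zero.\<close>

lemma char_poly_square_zero:
  fixes N :: "complex mat"
  assumes N: "N \<in> carrier_mat n n" and sq: "N * N = 0\<^sub>m n n"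
  shows "char_poly N = [:0, 1:] ^ n"
proof -
  obtain as where as: "char_poly N = (\<Prod>a\<leftarrow>as. [:- a, 1:])" and len: "length as = n"
    using char_poly_factorized[OF N] by blast
  have "a = 0" if "a \<in> set as" for a
  proof -
    have "poly (char_poly N) a = 0"
      using that unfolding as by (auto simp: poly_prod_list prod_list_zero_iff)
    then have "eigenvalue N a"
      using eigenvalue_root_char_poly[OF N] by blast
    then obtain v where v: "v \<in> carrier_vec n" "v \<noteq> 0\<^sub>v n" and Nv: "N *\<^sub>v v = a \<cdot>\<^sub>v v"
      using N unfolding eigenvalue_def eigenvector_def by auto
    have "0\<^sub>v n = (N * N) *\<^sub>v v"
      using v(1) by (auto simp: sq)
    also have "\<dots> = (a * a) \<cdot>\<^sub>v v"
      using N v(1) by (simp add: Nv mult_mat_vec smult_smult_assoc)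
    finally have "(a * a) \<cdot>\<^sub>v v = 0\<^sub>v n" ..
    moreover obtain i where "i < n" "v $ i \<noteq> 0"
      using v by (metis carrier_vecD eq_vecI index_zero_vec)
    ultimately show "a = 0"
      using v(1) by (auto dest!: arg_cong[where f = "\<lambda>w. w $ i"])
  qed
  then have "map (\<lambda>a. [:- a, 1:]) as = replicate n [:0, 1:]"
    unfolding len[symmetric] by (induction as) auto
  then show ?thesis
    by (simp add: as)
qed

lemma char_poly_add_square_zero:
  fixes A N :: "complex mat"
  assumes A: "A \<in> carrier_mat n n" and N: "N \<in> carrier_mat n n"
    and sq: "N * N = 0\<^sub>m n n" and AN: "A * N = k \<cdot>\<^sub>m N"
  shows "char_poly (A + N) = char_poly A"
proof -
  \<comment> \<open>\<open>char_matrix M x\<close> is M - xI, whereas the characteristic polynomial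
    takes the determinant of xI - M; this fixes the sign.\<close>
  have uminus_char: "- (char_matrix M x) = x \<cdot>\<^sub>m 1\<^sub>m n - M"
    if "M \<in> carrier_mat n n" for M :: "complex mat" and x
    using that by (intro eq_matI) (auto simp: char_matrix_def)
  \<comment> \<open>The factor (x - k)^n is kept on both sides so that x = k needs no separate
    treatment; it is cancelled only afterwards, as a nonzero polynomial.\<close>
  have "poly ([:- k, 1:] ^ n * char_poly (A + N)) x = poly ([:- k, 1:] ^ n * char_poly A) x" for x
  proof -
    have I: "x \<cdot>\<^sub>m 1\<^sub>m n \<in> carrier_mat n n" for x :: complex
      by simp
    have "(x \<cdot>\<^sub>m 1\<^sub>m n - A) * ((x - k) \<cdot>\<^sub>m 1\<^sub>m n - N)
        = x \<cdot>\<^sub>m ((x - k) \<cdot>\<^sub>m 1\<^sub>m n - N) - ((x - k) \<cdot>\<^sub>m A - k \<cdot>\<^sub>m N)"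
    proof -
      let ?Y = "(x - k) \<cdot>\<^sub>m 1\<^sub>m n - N"
      have Y: "?Y \<in> carrier_mat n n"
        using N by (rule minus_carrier_mat)
      have "(x \<cdot>\<^sub>m 1\<^sub>m n) * ?Y = x \<cdot>\<^sub>m ?Y"
        using mult_smult_assoc_mat[OF one_carrier_mat Y] left_mult_one_mat[OF Y] by simp
      moreover have "A * ?Y = (x - k) \<cdot>\<^sub>m A - k \<cdot>\<^sub>m N"
        using mult_minus_distrib_mat[OF A I N] mult_smult_distrib[OF A one_carrier_mat]
          right_mult_one_mat[OF A] AN by simp
      ultimately show ?thesis
        using minus_mult_distrib_mat[OF I A Y] by simp
    qed
    also have "\<dots> = (x - k) \<cdot>\<^sub>m (x \<cdot>\<^sub>m 1\<^sub>m n - (A + N))"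
      using A N by (intro eq_matI) (auto simp: algebra_simps)
    finally have "det ((x - k) \<cdot>\<^sub>m (x \<cdot>\<^sub>m 1\<^sub>m n - (A + N)))
        = det (x \<cdot>\<^sub>m 1\<^sub>m n - A) * det ((x - k) \<cdot>\<^sub>m 1\<^sub>m n - N)"
      using det_mult[OF minus_carrier_mat[OF A] minus_carrier_mat[OF N]] by metis
    moreover have "det ((x - k) \<cdot>\<^sub>m (x \<cdot>\<^sub>m 1\<^sub>m n - (A + N))) = (x - k) ^ n * poly (char_poly (A + N)) x"
      using A N by (simp add: char_poly_matrix[of _ n] uminus_char)
    moreover have "det (x \<cdot>\<^sub>m 1\<^sub>m n - A) = poly (char_poly A) x"
      using A by (simp add: char_poly_matrix[of _ n] uminus_char)
    \<comment> \<open>This determinant is the characteristic polynomial of \<open>N\<close>, which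
      is the n-th power of the variable, evaluated at x - k.\<close>
    moreover have "det ((x - k) \<cdot>\<^sub>m 1\<^sub>m n - N) = (x - k) ^ n"
      using char_poly_matrix[OF N, of "x - k"] N
      by (simp add: uminus_char char_poly_square_zero[OF N sq] poly_power)
    ultimately have "(x - k) ^ n * poly (char_poly (A + N)) x = (x - k) ^ n * poly (char_poly A) x"
      by (metis mult.commute)
    then show ?thesis
      by (simp add: poly_power)
  qed
  then have "[:- k, 1:] ^ n * char_poly (A + N) = [:- k, 1:] ^ n * char_poly A"
    by (intro iffD1[OF poly_eq_poly_eq_iff] ext)
  then show ?thesis
    by simp
qed

text \<open>Each column of the right factor is a multiple of the all-ones vector, which
  \<open>M\<close> maps to \<open>r\<close> times itself.\<close>

lemma mult_mat_mult_const_cols: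
  fixes M :: "'a :: comm_semiring_0 mat"
  assumes M: "M \<in> carrier_mat n n" and rows: "\<And>i. i < n \<Longrightarrow> (\<Sum>j<n. M $$ (i, j)) = r"
  shows "M * mat n n (\<lambda>(i, j). v j) = r \<cdot>\<^sub>m mat n n (\<lambda>(i, j). v j)"
proof (rule eq_matI)
  fix i j assume "i < dim_row (r \<cdot>\<^sub>m mat n n (\<lambda>(i, j). v j))" "j < dim_col (r \<cdot>\<^sub>m mat n n (\<lambda>(i, j). v j))"
  then have ij: "i < n" "j < n" by auto
  show "(M * mat n n (\<lambda>(i, j). v j)) $$ (i, j) = (r \<cdot>\<^sub>m mat n n (\<lambda>(i, j). v j)) $$ (i, j)"
    using M ij rows[OF ij(1)]
    by (simp add: scalar_prod_def sum_distrib_right[symmetric] atLeast0LessThan)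
qed (use M in auto)

lemma char_poly_add_const_cols:
  fixes A :: "real mat"
  assumes A: "A \<in> carrier_mat n n" and rows: "\<And>i. i < n \<Longrightarrow> (\<Sum>j<n. A $$ (i, j)) = r"
    and v: "(\<Sum>j<n. v j) = 0"
  shows "char_poly (map_mat complex_of_real (A + mat n n (\<lambda>(i, j). v j)))
    = char_poly (map_mat complex_of_real A)"
proof -
  let ?A = "map_mat complex_of_real A" and ?N = "mat n n (\<lambda>(i, j). complex_of_real (v j))"
  have "map_mat complex_of_real (A + mat n n (\<lambda>(i, j). v j)) = ?A + ?N"
    using A by (intro eq_matI) auto
  moreover have "?A * ?N = complex_of_real r \<cdot>\<^sub>m ?N"
  proof (rule mult_mat_mult_const_cols)
    fix i assume "i < n"
    then show "(\<Sum>j<n. ?A $$ (i, j)) = complex_of_real r"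
      using A rows[of i, symmetric] by simp
  qed (use A in simp)
  \<comment> \<open>Here the left factor is \<open>?N\<close> itself: its row sums are the sum of
    the \<open>v j\<close>, which vanishes, so \<open>r\<close> is 0.\<close>
  moreover have "?N * ?N = 0 \<cdot>\<^sub>m ?N"
    by (rule mult_mat_mult_const_cols) (auto simp: of_real_sum[symmetric] v)
  moreover have "0 \<cdot>\<^sub>m ?N = 0\<^sub>m n n"
    by (intro eq_matI) auto
  ultimately show ?thesis
    using char_poly_add_square_zero[of ?A n ?N] A by simp
qed

lemma spectral_radius_cong_char_poly:
  assumes "A \<in> carrier_mat n n" "B \<in> carrier_mat n n" "char_poly A = char_poly B"
  shows "spectral_radius A = spectral_radius B"
proof -
  have "eigenvalue A = eigenvalue B"
    using assms by (simp add: eigenvalue_root_char_poly fun_eq_iff)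
  then show ?thesis
    by (simp add: spectral_radius_def spectrum_def)
qed

lemma frobenius_norm_power2:
  "(frobenius_norm M)\<^sup>2 = (\<Sum>i<dim_row M. \<Sum>j<dim_col M. (M $$ (i, j))\<^sup>2)"
  by (simp add: frobenius_norm_def sum_nonneg)

lemma frobenius_norm_nonneg: "0 \<le> frobenius_norm M"
  by (simp add: frobenius_norm_def sum_nonneg)

lemma frobenius_norm_eq_0_iff:
  assumes "M \<in> carrier_mat m n"
  shows "frobenius_norm M = 0 \<longleftrightarrow> M = 0\<^sub>m m n"
proof
  assume "frobenius_norm M = 0"
  then have "M $$ (i, j) = 0" if "i < m" "j < n" for i j
    using assms that by (auto simp: frobenius_norm_def sum_nonneg sum_nonneg_eq_0_iff)
  with assms show "M = 0\<^sub>m m n"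
    by (intro eq_matI) auto
qed (simp add: frobenius_norm_def)

text \<open>In column \<open>j\<close> the first difference on the right is the constant
  \<open>- v j\<close>, while the entries of the second sum to zero by \<open>cols\<close>; the
  cross terms therefore cancel column by column.\<close>

lemma frobenius_pythagoras_const_cols:
  assumes "A \<in> carrier_mat n n" "X \<in> carrier_mat n n"
    and cols: "\<And>j. j < n \<Longrightarrow> (\<Sum>i<n. A $$ (i, j) + v j) = (\<Sum>i<n. X $$ (i, j))"
  shows "(frobenius_norm (A - X))\<^sup>2
    = (frobenius_norm (A - (A + mat n n (\<lambda>(i, j). v j))))\<^sup>2
      + (frobenius_norm (A + mat n n (\<lambda>(i, j). v j) - X))\<^sup>2"
proof -
  have "(\<Sum>i<n. (A $$ (i, j) - X $$ (i, j))\<^sup>2)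
      = (\<Sum>i<n. (v j)\<^sup>2) + (\<Sum>i<n. (A $$ (i, j) + v j - X $$ (i, j))\<^sup>2)" if "j < n" for j
  proof -
    \<comment> \<open>Expand the square of (a + v - x) - v.\<close>
    have "(\<Sum>i<n. (A $$ (i, j) - X $$ (i, j))\<^sup>2)
        = (\<Sum>i<n. (v j)\<^sup>2 + (A $$ (i, j) + v j - X $$ (i, j))\<^sup>2
            - 2 * v j * (A $$ (i, j) + v j - X $$ (i, j)))"
      by (intro sum.cong) (auto simp: power2_eq_square algebra_simps)
    also have "\<dots> = (\<Sum>i<n. (v j)\<^sup>2) + (\<Sum>i<n. (A $$ (i, j) + v j - X $$ (i, j))\<^sup>2)
        - 2 * v j * (\<Sum>i<n. A $$ (i, j) + v j - X $$ (i, j))"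
      unfolding sum_distrib_left by (subst sum_subtractf, subst sum.distrib) (rule refl)
    also have "(\<Sum>i<n. A $$ (i, j) + v j - X $$ (i, j)) = 0"
      using cols[OF that] by (simp only: sum_subtractf)
    finally show ?thesis by simp
  qed
  then have "(\<Sum>j<n. \<Sum>i<n. (A $$ (i, j) - X $$ (i, j))\<^sup>2)
      = (\<Sum>j<n. \<Sum>i<n. (v j)\<^sup>2) + (\<Sum>j<n. \<Sum>i<n. (A $$ (i, j) + v j - X $$ (i, j))\<^sup>2)"
    by (simp add: sum.distrib)
  then have "(\<Sum>i<n. \<Sum>j<n. (A $$ (i, j) - X $$ (i, j))\<^sup>2)
      = (\<Sum>i<n. \<Sum>j<n. (v j)\<^sup>2) + (\<Sum>i<n. \<Sum>j<n. (A $$ (i, j) + v j - X $$ (i, j))\<^sup>2)"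
    by (subst (1 2 3) sum.swap)
  then show ?thesis
    using assms(1,2) by (simp add: frobenius_norm_power2)
qed

theorem theorem2p8:
  fixes n :: nat and A :: "real mat" and ls :: "complex list"
  assumes "n \<ge> 1"
    and "stochastic n A"
    and "has_spectrum A 1 ls"
    and "\<forall>j<n. col_sum A j \<le> 1 + real n * col_min A j"
  shows "\<exists>B. doubly_stochastic n B \<and> has_spectrum B 1 ls
    \<and> closest_doubly_stochastic n A B
    \<and> (\<forall>C. closest_doubly_stochastic n A C \<longrightarrow> C = B)
    \<and> cospectral B A"
proof -
  define v where "v j = (1 - col_sum A j) / real n" for j
  define B where "B = A + mat n n (\<lambda>(i, j). v j)"
  from assms(2) have A: "A \<in> carrier_mat n n" and rowA: "\<And>i. i < n \<Longrightarrow> (\<Sum>j<n. A $$ (i, j)) = 1"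
    by (auto simp: stochastic_def)
  have B: "B \<in> carrier_mat n n"
    using A by (simp add: B_def)
  have entry: "B $$ (i, j) = A $$ (i, j) + v j" if "i < n" "j < n" for i j
    using A that by (simp add: B_def)
  \<comment> \<open>Counting all entries by columns and by rows gives total \<open>n\<close>, so the
    corrections \<open>v j\<close> add up to zero and leave the row sums of \<open>A\<close>
    unchanged.\<close>
  have "(\<Sum>j<n. col_sum A j) = (\<Sum>i<n. \<Sum>j<n. A $$ (i, j))"
    using A unfolding col_sum_def by (subst sum.swap) simp
  also have "\<dots> = real n"
    by (simp add: rowA)
  finally have v0: "(\<Sum>j<n. v j) = 0"
    by (simp add: v_def sum_divide_distrib[symmetric] sum_subtractf)
  have colB: "(\<Sum>i<n. A $$ (i, j) + v j) = 1" for j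
    using A assms(1) by (simp add: sum.distrib v_def col_sum_def)
  have "0 \<le> B $$ (i, j)" if "i < n" "j < n" for i j
  proof -
    have "col_min A j \<le> A $$ (i, j)"
      unfolding col_min_def using A that by (intro Min_le) auto
    \<comment> \<open>This is the assumed bound on \<open>col_sum A j\<close>, rearranged and
      divided by \<open>n\<close>.\<close>
    moreover have "- v j \<le> col_min A j"
      using assms(1,4) that by (simp add: v_def field_simps)
    ultimately show ?thesis
      by (simp add: entry[OF that])
  qed
  then have dsB: "doubly_stochastic n B"
    using B by (simp add: doubly_stochastic_def stochastic_def entry colB)
      (simp add: sum.distrib rowA v0)
  have cp: "char_poly (map_mat complex_of_real B) = char_poly (map_mat complex_of_real A)"
    unfolding B_def by (rule char_poly_add_const_cols[OF A rowA v0])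
  then have cosp: "cospectral B A"
    by (simp add: cospectral_def eigenvalue_mset_def)
  \<comment> \<open>Besides the multiset of eigenvalues, \<open>has_spectrum\<close> demands that 1
    be the spectral radius of \<open>B\<close>; this too depends only on the characteristic
    polynomial.\<close>
  have spec: "has_spectrum B 1 ls"
    using assms(3) cosp spectral_radius_cong_char_poly[OF _ _ cp, of n] A B
    by (simp add: has_spectrum_def cospectral_def)
  have pyth: "(frobenius_norm (A - X))\<^sup>2 = (frobenius_norm (A - B))\<^sup>2 + (frobenius_norm (B - X))\<^sup>2"
    if "doubly_stochastic n X" for X
    unfolding B_def using that
    by (intro frobenius_pythagoras_const_cols[OF A]) (simp_all add: doubly_stochastic_def stochastic_def colB)
  have le: "frobenius_norm (A - B) \<le> frobenius_norm (A - X)" if "doubly_stochastic n X" for X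
    by (rule power2_le_imp_le) (simp_all add: pyth[OF that] frobenius_norm_nonneg)
  have closest: "closest_doubly_stochastic n A B"
    using dsB le by (auto simp: closest_doubly_stochastic_def is_arg_min_def not_less)
  have "C = B" if "closest_doubly_stochastic n A C" for C
  proof -
    from that dsB have dsC: "doubly_stochastic n C"
      and "frobenius_norm (A - C) \<le> frobenius_norm (A - B)"
      by (auto simp: closest_doubly_stochastic_def is_arg_min_def not_less)
    \<comment> \<open>Two minimisers are equally far from \<open>A\<close>, so the Pythagorean
      identity leaves no room for a nonzero \<open>B - C\<close>.\<close>
    with le have "frobenius_norm (A - C) = frobenius_norm (A - B)"
      by (simp add: order_antisym)
    then have "frobenius_norm (B - C) = 0"
      using pyth[OF dsC] by simp
    moreover have C: "C \<in> carrier_mat n n"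
      using dsC by (simp add: doubly_stochastic_def stochastic_def)
    ultimately have D: "B - C = 0\<^sub>m n n"
      using B by (subst (asm) frobenius_norm_eq_0_iff[of _ n n]) auto
    show "C = B"
    proof (rule eq_matI)
      fix i j assume "i < dim_row B" "j < dim_col B"
      with B C arg_cong[OF D, of "\<lambda>M. M $$ (i, j)"] show "C $$ (i, j) = B $$ (i, j)"
        by simp
    qed (use B C in auto)
  qed
  with dsB spec closest cosp show ?thesis
    by blast
qed

end
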